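(* Let $0<\lambda\le 1$, $\mu>0$, $\nu>0$, and let $S:[0,1]\to[0,1]$ be the piecewise fractional linear map of type $(+,-,-)$ on the partition $0<\frac13<\frac12<1$ with inverse branches $$V_\lambda x=\frac{\lambda x}{1+(3\lambda-1)x},\quad V_\mu x=\frac{1+(\mu-1)x}{2+(3\mu-2)x},\quad V_\nu x=\frac{1+(\nu-1)x}{1+(2\nu-1)x},$$ with dual branches $$V^*_\lambda y=3\lambda-1+\lambda y,\quad V^*_\mu y=\frac{3\mu-2+(\mu-1)y}{2+y},\quad V^*_\nu y=\frac{2\nu-1+(\nu-1)y}{1+y}.$$ Let $\xi=\frac{3\lambda-1}{1-\lambda}$ be the fixed point of $V^*_\lambda$ ($\xi=\infty$ if $\lambda=1$). Suppose that $$\eta=V^*_\mu\xi=V^*_\nu\xi\quad\text{and}\quad V^*_\mu\eta=V^*_{\nu\nu}\eta,\qquad\text{where } V^*_{\nu\nu}=V^*_\nu\circ V^*_\nu .$$ (1) If $\xi=\eta$, then $S$ has a natural dual and the density of the invariant measure of $S$ is (up to a multiplicative constant) $$g(x)=\frac{1}{(1+\xi x)^2}.$$ (2) If $\xi\ne\eta$, then $\nu=\mu$ and $\lambda=1$, the map $S$ is a $1$-step extension, and the density of the invariant measure of $S$ is (up to a multiplicative constant) $$g(x)=\frac1x\sum_{n=0}^\infty\frac{(-1)^n}{1+(\nu+n-1)x}.$$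
   Context: The map $S$ is defined on the interior of each cylinder $B(k)=V_k[0,1]$ ($k\in\{\lambda,\mu,\nu\}$; these are $[0,\frac13],[\frac13,\frac12],[\frac12,1]$ respectively) as the inverse of $V_k$. Type $(+,-,-)$ means that $V_\lambda$ is increasing and $V_\mu,V_\nu$ are decreasing. The maps $V_k^*$ act on $\mathbb{R}\cup\{\infty\}$ with the usual conventions for fractional linear maps. Density of the invariant measure: a positive measurable function $g$ on $(0,1)$ with $g(x)=\sum_{k}g(V_kx)\,|V_k'(x)|$, understood up to a multiplicative constant. Dual: for $V_kx=\frac{c_k+d_kx}{a_k+b_kx}$ the adjoint branch is $V^*_ky=\frac{b_k+d_ky}{a_k+c_ky}$. A dual map of $S$ is a piecewise fractional linear map $S^*:B^*\to B^*$ on an interval $B^*$ whose inverse branches are the $V_k^*$. It is a natural dual if there is a map $\psi(t)=\frac{B+Dt}{A+Bt}$ with $\psi\circ V_k=V_k^*\circ\psi$ for all $k$. The degenerate case in which $B^*$ shrinks to a single point $\xi$ (so that $V_k^*\xi=\xi$ for all $k$, and $\psi$ is the constant $\xi$) is counted as a natural dual. $1$-step extension: given a piecewise fractional linear map $T:[0,1]\to[0,1]$ with partition $0<\frac12<1$ and two inverse branches, each mapping $[0,1]$ onto one of the two cylinders $[0,\frac12],[\frac12,1]$, choose one cylinder $B(\alpha)$ and let $B(\beta)$ be the other one. The map equal to $T^2$ on $B(\alpha)$ and equal to $T$ on $B(\beta)$, which has three branches, is called a $1$-step extension of $T$. A three-branch map is called a $1$-step extension if it arises in this way. *)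

theory Defs
  imports "HOL-Analysis.Analysis"
begin

section \<open>Fractional linear maps and their adjoints\<close>

text \<open>\<open>FL a b c d\<close> stands for \<open>x \<mapsto> (c + d x) / (a + b x)\<close>.\<close>

datatype frac_lin = FL (fa: real) (fb: real) (fc: real) (fd: real)

definition fl_det :: "frac_lin \<Rightarrow> real" where
  "fl_det v = fa v * fd v - fb v * fc v"

definition fl :: "frac_lin \<Rightarrow> real \<Rightarrow> real" where
  "fl v x = (fc v + fd v * x) / (fa v + fb v * x)"

text \<open>
  The projective line is \<open>real option\<close>, with \<open>None\<close> as the point at infinity; its topology is the
  library's one-point compactification of the reals. \<open>pfl\<close> is only meaningful for a nonzero
  determinant (otherwise numerator and denominator may vanish together).
\<close>

abbreviation proj_line :: "real option topology" where
  "proj_line \<equiv> Alexandroff_compactification euclideanreal"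

fun pfl :: "frac_lin \<Rightarrow> real option \<Rightarrow> real option" where
  "pfl v (Some x) = (if fa v + fb v * x = 0 then None else Some (fl v x))"
| "pfl v None = (if fb v = 0 then None else Some (fd v / fb v))"

definition adj :: "frac_lin \<Rightarrow> frac_lin" where
  "adj v = FL (fa v) (fc v) (fb v) (fd v)"

section \<open>Piecewise fractional linear maps with full branches on the unit interval\<close>

text \<open>A branch is a genuine (nonsingular, pole-free) fractional linear map on \<open>[0,1]\<close>;
  division by zero would otherwise hide a pole.\<close>

definition fl_branch :: "frac_lin \<Rightarrow> bool" where
  "fl_branch v \<longleftrightarrow> fl_det v \<noteq> 0 \<and> (\<forall>x\<in>{0..1}. fa v + fb v * x \<noteq> 0)"

text \<open>
  \<open>p\<close> lists the partition points \<open>0 = p\<^sub>0 < \<dots> < p\<^sub>n = 1\<close>, and \<open>V\<close> the inverse branches in the order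
  of their cylinders. The values of \<open>S\<close> at the partition points are left open.
\<close>

definition pfl_map :: "real list \<Rightarrow> frac_lin list \<Rightarrow> (real \<Rightarrow> real) \<Rightarrow> bool" where
  "pfl_map p V S \<longleftrightarrow>
     length p = Suc (length V) \<and> sorted_wrt (<) p \<and> hd p = 0 \<and> last p = 1 \<and>
     S \<in> {0..1} \<rightarrow> {0..1} \<and>
     (\<forall>i<length V.
        fl_branch (V ! i) \<and>
        fl (V ! i) ` {0..1} = {p ! i..p ! Suc i} \<and>
        (\<forall>x\<in>{p ! i<..<p ! Suc i}. S x = the_inv_into {0..1} (fl (V ! i)) x))"

datatype branch_sign = Plus | Minus

definition has_type :: "branch_sign list \<Rightarrow> frac_lin list \<Rightarrow> bool" where
  "has_type \<epsilon> V \<longleftrightarrow>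
     list_all2 (\<lambda>e v. case e of Plus \<Rightarrow> strict_mono_on {0..1} (fl v)
                              | Minus \<Rightarrow> strict_antimono_on {0..1} (fl v)) \<epsilon> V"

text \<open>Densities are normalised only up to a positive factor; they need not be integrable.\<close>

definition invariant_density :: "frac_lin list \<Rightarrow> (real \<Rightarrow> real) \<Rightarrow> bool" where
  "invariant_density V g \<longleftrightarrow>
     g \<in> borel_measurable (restrict_space borel {0<..<1}) \<and>
     (\<forall>x\<in>{0<..<1}. g x > 0) \<and>
     (\<forall>x\<in>{0<..<1}. g x = (\<Sum>v\<leftarrow>V. g (fl v x) * \<bar>deriv (fl v) x\<bar>))"

section \<open>Dual maps and natural duals\<close>

text \<open>Intervals of the projective line are taken closed, like \<open>[0,1]\<close>; they may contain infinity.\<close>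

definition proj_interval :: "real option set \<Rightarrow> bool" where
  "proj_interval B \<longleftrightarrow>
     closedin proj_line B \<and> connectedin proj_line B \<and>
     proj_line interior_of B \<noteq> {} \<and> B \<noteq> UNIV"

definition dual_map ::
  "frac_lin list \<Rightarrow> real option set \<Rightarrow> (real option \<Rightarrow> real option) \<Rightarrow> bool" where
  "dual_map V B S' \<longleftrightarrow>
     proj_interval B \<and> S' \<in> B \<rightarrow> B \<and>
     (\<Union>v\<in>set V. pfl (adj v) ` B) = B \<and>
     (\<forall>i<length V. \<forall>j<length V. i \<noteq> j \<longrightarrow>
        disjnt (proj_line interior_of (pfl (adj (V ! i)) ` B))
               (proj_line interior_of (pfl (adj (V ! j)) ` B))) \<and>
     (\<forall>v\<in>set V. fl_det (adj v) \<noteq> 0 \<and>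
        (\<forall>y\<in>proj_line interior_of (pfl (adj v) ` B). S' y = the_inv_into B (pfl (adj v)) y))"

text \<open>
  The conjugating map is \<open>\<psi>(t) = (B + D t) / (A + B t)\<close>. If it is singular, it is a constant \<open>\<xi>\<close>
  fixed by all adjoint branches; this is the degenerate case, given by the second disjunct.
\<close>

definition has_natural_dual :: "frac_lin list \<Rightarrow> bool" where
  "has_natural_dual V \<longleftrightarrow>
     (\<exists>I S' A B D. dual_map V I S' \<and> fl_det (FL A B B D) \<noteq> 0 \<and>
        (\<forall>v\<in>set V. pfl (FL A B B D) \<circ> pfl v = pfl (adj v) \<circ> pfl (FL A B B D))) \<or>
     (\<exists>\<xi>. \<forall>v\<in>set V. pfl (adj v) \<xi> = \<xi>)"

section \<open>1-step extensions\<close>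

text \<open>\<open>p\<close> lists the partition points of \<open>S\<close>, where nothing is required.\<close>

definition one_step_extension :: "real list \<Rightarrow> (real \<Rightarrow> real) \<Rightarrow> bool" where
  "one_step_extension p S \<longleftrightarrow>
     (\<exists>T W\<^sub>0 W\<^sub>1 B\<^sub>\<alpha> B\<^sub>\<beta>.
        pfl_map [0, 1/2, 1] [W\<^sub>0, W\<^sub>1] T \<and>
        {B\<^sub>\<alpha>, B\<^sub>\<beta>} = {{0..1/2}, {1/2..1}} \<and>
        (\<forall>x\<in>interior B\<^sub>\<alpha> - set p. S x = T (T x)) \<and>
        (\<forall>x\<in>interior B\<^sub>\<beta> - set p. S x = T x))"

section \<open>The three branches\<close>

definition V_lam :: "real \<Rightarrow> frac_lin" where
  "V_lam l = FL 1 (3 * l - 1) 0 l"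

definition V_mu :: "real \<Rightarrow> frac_lin" where
  "V_mu \<mu> = FL 2 (3 * \<mu> - 2) 1 (\<mu> - 1)"

definition V_nu :: "real \<Rightarrow> frac_lin" where
  "V_nu \<nu> = FL 1 (2 * \<nu> - 1) 1 (\<nu> - 1)"

lemma fl_V:
  "fl (V_lam l) x = l * x / (1 + (3 * l - 1) * x)"
  "fl (V_mu \<mu>) x = (1 + (\<mu> - 1) * x) / (2 + (3 * \<mu> - 2) * x)"
  "fl (V_nu \<nu>) x = (1 + (\<nu> - 1) * x) / (1 + (2 * \<nu> - 1) * x)"
  by (simp_all add: fl_def V_lam_def V_mu_def V_nu_def)

lemma pfl_adj_V:
  "pfl (adj (V_lam l)) (Some y) = Some (3 * l - 1 + l * y)"
  "pfl (adj (V_mu \<mu>)) (Some y) =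
     (if 2 + y = 0 then None else Some ((3 * \<mu> - 2 + (\<mu> - 1) * y) / (2 + y)))"
  "pfl (adj (V_nu \<nu>)) (Some y) =
     (if 1 + y = 0 then None else Some ((2 * \<nu> - 1 + (\<nu> - 1) * y) / (1 + y)))"
  "pfl (adj (V_lam l)) None = None"
  "pfl (adj (V_mu \<mu>)) None = Some (\<mu> - 1)"
  "pfl (adj (V_nu \<nu>)) None = Some (\<nu> - 1)"
  by (simp_all add: fl_def adj_def V_lam_def V_mu_def V_nu_def)

end

theory Submission
  imports Defs
begin

text \<open>
  If \<open>l < 1\<close>, put \<open>X = 1 + \<xi> > 0\<close> and \<open>E = 1 + \<eta>\<close>. The first condition on \<open>\<eta>\<close> gives
  \<open>\<mu> = E (X + 1) / (X + 2)\<close> and \<open>\<nu> = E X / (X + 1)\<close>, and with these the second one collapses to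
  \<open>E = X\<close>. So \<open>\<xi>\<close> is a common fixed point of the adjoint branches, and each branch multiplies
  \<open>1 / (1 + \<xi> x)\<^sup>2\<close> by a constant; the three constants add up to 1.

  If \<open>l = 1\<close>, then \<open>\<xi> = \<infinity>\<close> and \<open>\<eta> = \<mu> - 1 = \<nu> - 1\<close>. With \<open>W x = x / (1 + x)\<close> one has
  \<open>V\<^sub>\<lambda> = W \<circ> W\<close> and \<open>V\<^sub>\<mu> = W \<circ> V\<^sub>\<nu>\<close>, so \<open>S\<close> extends the map with branches \<open>W\<close> and \<open>V\<^sub>\<nu>\<close>. In the
  transfer equation for the alternating series, \<open>V\<^sub>\<lambda>\<close> shifts the series by two terms, while the
  contributions of \<open>V\<^sub>\<mu>\<close> and \<open>V\<^sub>\<nu>\<close> telescope to the two missing terms.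
\<close>

section \<open>Fractional linear branches and densities from a common fixed point\<close>

lemma deriv_fl:
  assumes "fa v + fb v * x \<noteq> 0"
  shows "deriv (fl v) x = fl_det v / (fa v + fb v * x)\<^sup>2"
proof (rule DERIV_imp_deriv)
  show "(fl v has_real_derivative fl_det v / (fa v + fb v * x)\<^sup>2) (at x)"
    unfolding fl_def fl_det_def
    by (rule derivative_eq_intros refl assms)+ (use assms in \<open>simp add: power2_eq_square algebra_simps\<close>)
qed

lemma inj_on_fl:
  assumes "fl_branch v"
  shows "inj_on (fl v) {0..1}"
proof (rule inj_onI)
  fix x y :: real
  assume x: "x \<in> {0..1}" and y: "y \<in> {0..1}" and eq: "fl v x = fl v y"
  have nz: "fa v + fb v * x \<noteq> 0" "fa v + fb v * y \<noteq> 0"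
    using assms x y by (auto simp: fl_branch_def)
  have "(fc v + fd v * x) * (fa v + fb v * y) = (fc v + fd v * y) * (fa v + fb v * x)"
    using eq nz by (simp add: fl_def frac_eq_eq)
  then have "fl_det v * (x - y) = 0"
    by (simp add: fl_det_def algebra_simps)
  then show "x = y"
    using assms by (simp add: fl_branch_def)
qed

lemma the_inv_into_fl_eq:
  assumes "fl_branch v" "y \<in> {0..1}" "fl v y = x"
  shows "the_inv_into {0..1} (fl v) x = y"
  using the_inv_into_f_eq[OF inj_on_fl] assms by blast

text \<open>Duality of the kernel: \<open>(a + b x) (1 + s V x) = (a + c s) (1 + x V^* s)\<close>.
  The assumption \<open>fixed\<close> is \<open>V^* s = s\<close> with the denominator cleared, so
  the density is an eigenfunction of each single branch operator.\<close>

lemma transfer_fixed_point_density: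
  assumes pole: "fa v + fb v * x \<noteq> 0" and nz: "fa v + fc v * s \<noteq> 0"
    and fixed: "fb v + fd v * s = s * (fa v + fc v * s)"
  shows "1 / (1 + s * fl v x)\<^sup>2 * \<bar>deriv (fl v) x\<bar>
         = \<bar>fl_det v\<bar> / (fa v + fc v * s)\<^sup>2 * (1 / (1 + s * x)\<^sup>2)"
proof -
  have "(fa v + fb v * x) + s * (fc v + fd v * x) = (fa v + fc v * s) + (fb v + fd v * s) * x"
    by (simp add: algebra_simps)
  also have "\<dots> = (fa v + fc v * s) * (1 + s * x)"
    unfolding fixed by (simp add: algebra_simps)
  finally have "1 + s * fl v x = (fa v + fc v * s) * (1 + s * x) / (fa v + fb v * x)"
    using pole by (simp add: fl_def field_simps)
  then show ?thesis
    using pole nz by (simp add: deriv_fl power_mult_distrib power_divide abs_divide)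
qed

lemma one_plus_mult_pos:
  assumes "c > -1" "x \<in> {0<..<1::real}"
  shows "1 + c * x > 0"
proof -
  have "(1 + c) * x > 0"
    using assms by (intro mult_pos_pos) auto
  then show ?thesis
    using assms by (simp add: algebra_simps)
qed

text \<open>Each branch reproduces the density up to a constant factor, so invariance reduces to
  \<open>one\<close>: these factors have sum 1.\<close>

lemma invariant_density_fixed_point:
  assumes s: "s > -1"
    and branches: "\<And>v. v \<in> set V \<Longrightarrow> fl_branch v"
    and fixed: "\<And>v. v \<in> set V \<Longrightarrow>
                  fa v + fc v * s \<noteq> 0 \<and> fb v + fd v * s = s * (fa v + fc v * s)"
    and one: "(\<Sum>v\<leftarrow>V. \<bar>fl_det v\<bar> / (fa v + fc v * s)\<^sup>2) = 1"
  shows "invariant_density V (\<lambda>x. 1 / (1 + s * x)\<^sup>2)"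
  unfolding invariant_density_def
proof (intro conjI ballI)
  show "(\<lambda>x. 1 / (1 + s * x)\<^sup>2) \<in> borel_measurable (restrict_space borel {0<..<1})"
    by (intro measurable_restrict_space1) measurable
next
  fix x :: real
  assume x: "x \<in> {0<..<1}"
  have "1 + s * x > 0"
    using s x by (rule one_plus_mult_pos)
  then show "1 / (1 + s * x)\<^sup>2 > 0"
    by simp
  have "(\<Sum>v\<leftarrow>V. 1 / (1 + s * fl v x)\<^sup>2 * \<bar>deriv (fl v) x\<bar>)
      = (\<Sum>v\<leftarrow>V. \<bar>fl_det v\<bar> / (fa v + fc v * s)\<^sup>2 * (1 / (1 + s * x)\<^sup>2))"
    using branches fixed x
    by (intro arg_cong[where f = sum_list] map_cong refl transfer_fixed_point_density)
       (auto simp: fl_branch_def)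
  also have "\<dots> = 1 / (1 + s * x)\<^sup>2"
    by (simp only: sum_list_mult_const one mult_1_left)
  finally show "1 / (1 + s * x)\<^sup>2 = (\<Sum>v\<leftarrow>V. 1 / (1 + s * fl v x)\<^sup>2 * \<bar>deriv (fl v) x\<bar>)"
    by simp
qed

section \<open>The case \<open>l < 1\<close>: a common fixed point of the adjoint branches\<close>

text \<open>In the coordinate \<open>Y = y + 1\<close> the branch is
  \<open>Y -> \<mu> (Y + 2) / (Y + 1)\<close>, and the one for \<open>V_nu\<close> is
  \<open>Y -> \<nu> (Y + 1) / Y\<close>. For positive parameters both preserve \<open>Y > 0\<close>,
  so infinity never enters the orbits considered.\<close>

lemma adj_mu_eq:
  assumes "(y::real) > -1"
  shows "pfl (adj (V_mu \<mu>)) (Some y) = Some (\<mu> * (y + 3) / (y + 2) - 1)"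
  using assms unfolding pfl_adj_V by (auto simp: field_simps)

lemma adj_nu_eq:
  assumes "(y::real) > -1"
  shows "pfl (adj (V_nu \<nu>)) (Some y) = Some (\<nu> * (y + 2) / (y + 1) - 1)"
  using assms unfolding pfl_adj_V by (auto simp: field_simps)

text \<open>\<open>X\<close>, \<open>E\<close> and \<open>F\<close> are the shifted coordinates of
  \<xi>, \<eta> and the image of \<eta> under the adjoint of \<open>V_nu\<close>. Eliminating \<mu>
  and \<nu> and cancelling \<open>E\<close> leaves a linear equation for \<open>E\<close>: its
  coefficient is \<open>(X + 1)^2 - X (X + 2) = 1\<close>, and the other terms add up to
  \<open>- X\<close>.\<close>

lemma finite_orbit_condition:
  fixes X E \<mu> \<nu> :: real
  assumes pos: "X > 0" "E > 0" "\<nu> > 0"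
    and E_mu: "E = \<mu> * (X + 2) / (X + 1)" and E_nu: "E = \<nu> * (X + 1) / X"
    and F: "F = \<nu> * (E + 1) / E" and eq: "\<mu> * (E + 2) / (E + 1) = \<nu> * (F + 1) / F"
  shows "E = X"
proof -
  have mu: "\<mu> = E * (X + 1) / (X + 2)"
    using E_mu pos by simp
  have nu: "\<nu> = E * X / (X + 1)"
    using E_nu pos by simp
  have "\<nu> * (F + 1) / F = (\<nu> * (E + 1) + E) / (E + 1)"
    using pos by (simp add: F divide_simps)
  then have "\<mu> * (E + 2) = \<nu> * (E + 1) + E"
    using eq pos by simp
  then have "E * ((X + 1) * (E + 2) * (X + 1)) = E * (X * (E + 1) * (X + 2) + (X + 1) * (X + 2))"
    using pos by (simp add: mu nu divide_simps) (simp add: algebra_simps)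
  then have "(X + 1) * (E + 2) * (X + 1) = X * (E + 1) * (X + 2) + (X + 1) * (X + 2)"
    using pos by simp
  then show ?thesis
    by (simp add: algebra_simps)
qed

text \<open>The natural dual obtained is the degenerate one, a single point fixed by all three
  adjoint branches.\<close>

lemma common_fixed_point:
  fixes l \<mu> \<nu> s :: real
  assumes pos: "0 < l" "l < 1" "\<mu> > 0" "\<nu> > 0"
    and branches: "fl_branch (V_lam l)" "fl_branch (V_mu \<mu>)" "fl_branch (V_nu \<nu>)"
    and s: "s = (3 * l - 1) / (1 - l)"
    and eta_mu: "\<eta> = pfl (adj (V_mu \<mu>)) (Some s)"
    and eta_nu: "\<eta> = pfl (adj (V_nu \<nu>)) (Some s)"
    and munu: "pfl (adj (V_mu \<mu>)) \<eta> = pfl (adj (V_nu \<nu>)) (pfl (adj (V_nu \<nu>)) \<eta>)"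
  shows "\<eta> = Some s" and "has_natural_dual [V_lam l, V_mu \<mu>, V_nu \<nu>]"
    and "invariant_density [V_lam l, V_mu \<mu>, V_nu \<nu>] (\<lambda>x. 1 / (1 + s * x)\<^sup>2)"
proof -
  define X where "X = s + 1"
  have X: "X = 2 * l / (1 - l)"
    using pos by (simp add: X_def s field_simps)
  have X_pos: "X > 0"
    using pos by (simp add: X)
  have s_eq: "s = X - 1"
    by (simp add: X_def)
  define E where "E = \<mu> * (X + 2) / (X + 1)"
  have E_pos: "E > 0"
    using pos X_pos by (simp add: E_def)
  have eta: "\<eta> = Some (E - 1)"
    using eta_mu X_pos by (simp add: adj_mu_eq s_eq E_def add.commute del: pfl.simps)
  have E_nu: "E = \<nu> * (X + 1) / X"
    using eta_nu X_pos by (simp add: eta adj_nu_eq s_eq del: pfl.simps)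
  define F where "F = \<nu> * (E + 1) / E"
  have F_pos: "F > 0"
    using pos E_pos by (simp add: F_def)
  have "pfl (adj (V_nu \<nu>)) (Some (E - 1)) = Some (F - 1)"
    using E_pos by (simp add: adj_nu_eq F_def del: pfl.simps)
  then have "\<mu> * (E + 2) / (E + 1) = \<nu> * (F + 1) / F"
    using munu E_pos F_pos by (simp add: eta adj_mu_eq adj_nu_eq add.commute del: pfl.simps)
  then have EX: "E = X"
    using finite_orbit_condition X_pos E_pos pos(4) E_def E_nu F_def by blast
  then show eta_s: "\<eta> = Some s"
    by (simp add: eta s_eq)
  have "pfl (adj (V_lam l)) (Some s) = Some s"
    using pos by (simp add: pfl_adj_V s field_simps del: pfl.simps)
  then have "\<forall>v\<in>set [V_lam l, V_mu \<mu>, V_nu \<nu>]. pfl (adj v) (Some s) = Some s"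
    using eta_mu[symmetric] eta_nu[symmetric] eta_s by (simp del: pfl.simps)
  then show "has_natural_dual [V_lam l, V_mu \<mu>, V_nu \<nu>]"
    unfolding has_natural_dual_def by blast
  \<comment> \<open>With \<open>E = X\<close> all three parameters are functions of \<open>X\<close>
    alone, so that the condition on the branch factors becomes a rational identity in
    \<open>X\<close>.\<close>
  have lam: "l = X / (X + 2)"
    using pos by (simp add: X field_simps)
  have mu: "\<mu> = X * (X + 1) / (X + 2)"
    using E_def EX X_pos by (simp add: field_simps)
  have nu: "\<nu> = X * X / (X + 1)"
    using E_nu EX X_pos by (simp add: field_simps)
  have dets: "fl_det (V_lam l) = l" "fl_det (V_mu \<mu>) = - \<mu>" "fl_det (V_nu \<nu>) = - \<nu>"
    by (simp_all add: fl_det_def V_lam_def V_mu_def V_nu_def)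
  show "invariant_density [V_lam l, V_mu \<mu>, V_nu \<nu>] (\<lambda>x. 1 / (1 + s * x)\<^sup>2)"
  proof (rule invariant_density_fixed_point)
    show "s > -1"
      using X_pos by (simp add: s_eq)
    show "fl_branch v" if "v \<in> set [V_lam l, V_mu \<mu>, V_nu \<nu>]" for v
      using that branches by auto
    have "l * (X + 2) = X"
      using X_pos by (simp add: lam)
    then have "fb (V_lam l) + fd (V_lam l) * s = s" "fa (V_lam l) = 1" "fc (V_lam l) = 0"
      by (simp_all add: V_lam_def s_eq algebra_simps)
    moreover have "\<mu> * (X + 2) = X * (X + 1)"
      using X_pos by (simp add: mu)
    then have "fb (V_mu \<mu>) + fd (V_mu \<mu>) * s = s * (2 + s)" "fa (V_mu \<mu>) = 2" "fc (V_mu \<mu>) = 1"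
      by (simp_all add: V_mu_def s_eq algebra_simps)
    moreover have "\<nu> * (X + 1) = X * X"
      using X_pos by (simp add: nu)
    then have "fb (V_nu \<nu>) + fd (V_nu \<nu>) * s = s * (1 + s)" "fa (V_nu \<nu>) = 1" "fc (V_nu \<nu>) = 1"
      by (simp_all add: V_nu_def s_eq algebra_simps)
    ultimately show "fa v + fc v * s \<noteq> 0 \<and> fb v + fd v * s = s * (fa v + fc v * s)"
      if "v \<in> set [V_lam l, V_mu \<mu>, V_nu \<nu>]" for v
      using that X_pos by (auto simp: s_eq)
    \<comment> \<open>At \<open>s = X - 1\<close> the denominators \<open>fa v + fc v * s\<close>
      are 1, \<open>X + 1\<close> and \<open>X\<close>.\<close>
    have "\<mu> / (X + 1)\<^sup>2 = X / ((X + 1) * (X + 2))"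
      using X_pos by (simp add: mu power2_eq_square)
    moreover have "\<nu> / X\<^sup>2 = 1 / (X + 1)"
      using X_pos by (simp add: nu power2_eq_square)
    moreover have "X / (X + 2) + (X / ((X + 1) * (X + 2)) + 1 / (X + 1)) = 1"
      using X_pos by (simp add: divide_simps) (simp add: algebra_simps)
    ultimately have "l + (\<mu> / (X + 1)\<^sup>2 + \<nu> / X\<^sup>2) = 1"
      by (simp add: lam)
    then show "(\<Sum>v\<leftarrow>[V_lam l, V_mu \<mu>, V_nu \<nu>]. \<bar>fl_det v\<bar> / (fa v + fc v * s)\<^sup>2) = 1"
      using pos by (simp add: dets) (simp add: V_lam_def V_mu_def V_nu_def s_eq add.commute)
  qed
qed

section \<open>The case \<open>l = 1\<close>: the 1-step extension\<close>

text \<open>The map is iterated on the left cylinder. There \<open>T x\<close> falls into the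
  cylinder of \<open>W\<close> for \<open>x < 1/3\<close> and into that of \<open>V_nu\<close> for
  \<open>x > 1/3\<close>, which produces the partition point 1/3.\<close>

lemma one_step_extension_if_lam_1:
  assumes S_map: "pfl_map [0, 1/3, 1/2, 1] [V_lam 1, V_mu \<nu>, V_nu \<nu>] S"
  shows "one_step_extension [0, 1/3, 1/2, 1] S"
proof -
  have branch: "fl_branch ([V_lam 1, V_mu \<nu>, V_nu \<nu>] ! i)"
    and image: "fl ([V_lam 1, V_mu \<nu>, V_nu \<nu>] ! i) ` {0..1} = {[0, 1/3, 1/2, 1] ! i..[0, 1/3, 1/2, 1] ! Suc i}"
    and S_eq: "\<And>x. x \<in> {[0, 1/3, 1/2, 1] ! i<..<[0, 1/3, 1/2, 1] ! Suc i} \<Longrightarrow>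
                 S x = the_inv_into {0..1} (fl ([V_lam 1, V_mu \<nu>, V_nu \<nu>] ! i)) x"
    if "i < 3" for i
    using S_map that by (auto simp: pfl_map_def)
  have S_range: "S \<in> {0..1} \<rightarrow> {0..1}"
    using S_map by (simp add: pfl_map_def)
  note lam = branch[of 0, simplified] S_eq[of 0, simplified]
  note mu = branch[of 1, simplified] S_eq[of 1, simplified]
  note nu = branch[of 2, simplified] image[of 2, simplified] S_eq[of 2, simplified]
  define W where "W = FL 1 1 0 1"
  have fl_W: "fl W x = x / (1 + x)" for x
    by (simp add: fl_def W_def)
  have fl_W_inv: "fl W (x / (1 - x)) = x" "x / (1 - x) \<in> {0..1}" if "x \<in> {0..1/2}" for x :: real
    using that by (auto simp: fl_W field_simps)
  have W_branch: "fl_branch W"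
    by (auto simp: fl_branch_def fl_det_def W_def)
  have W_image: "fl W ` {0..1} = {0..1/2}"
  proof
    show "fl W ` {0..1} \<subseteq> {0..1/2}"
      by (auto simp: fl_W field_simps)
    show "{0..1/2} \<subseteq> fl W ` {0..1}"
      using fl_W_inv by (metis image_eqI subsetI)
  qed
  \<comment> \<open>The left formula inverts \<open>W\<close>. Using it at 1/2 as well gives the
    value 1 there, whatever \<open>S\<close> does at that point.\<close>
  define T where "T = (\<lambda>x::real. if x \<le> 1/2 then x / (1 - x) else S x)"
  have T_low: "T x = x / (1 - x)" if "x \<le> 1/2" for x
    using that by (simp add: T_def)
  have T_high: "T x = S x" if "x > 1/2" for x
    using that by (simp add: T_def)
  have T_range: "T \<in> {0..1} \<rightarrow> {0..1}"
  proof
    fix x :: real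
    assume x: "x \<in> {0..1}"
    show "T x \<in> {0..1}"
    proof (cases "x \<le> 1/2")
      case True
      then show ?thesis
        using fl_W_inv(2)[of x] x by (simp add: T_low)
    next
      case False
      then show ?thesis
        using S_range x by (auto simp: T_high)
    qed
  qed
  have "pfl_map [0, 1/2, 1] [W, V_nu \<nu>] T"
    unfolding pfl_map_def
  proof (intro conjI allI impI)
    fix i
    assume "i < length [W, V_nu \<nu>]"
    then consider "i = 0" | "i = 1"
      by fastforce
    note i_cases = this
    show "fl_branch ([W, V_nu \<nu>] ! i)"
      using i_cases W_branch nu(1) by cases auto
    show "fl ([W, V_nu \<nu>] ! i) ` {0..1} = {[0, 1/2, 1] ! i..[0, 1/2, 1] ! Suc i}"
      using i_cases W_image nu(2) by cases auto
    show "\<forall>x\<in>{[0, 1/2, 1] ! i<..<[0, 1/2, 1] ! Suc i}. T x = the_inv_into {0..1} (fl ([W, V_nu \<nu>] ! i)) x"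
      using i_cases
    proof cases
      case 1
      then show ?thesis
        using the_inv_into_fl_eq[OF W_branch fl_W_inv(2,1)] by (auto simp: T_low)
    next
      case 2
      then show ?thesis
        using nu(3) by (auto simp: T_high)
    qed
  qed (use T_range in auto)
  moreover have "S x = T (T x)" if "x \<in> interior {0..1/2} - set [0, 1/3, 1/2, 1]" for x
  proof -
    have x: "0 < x" "x < 1/2" "x \<noteq> 1/3"
      using that by auto
    show ?thesis
    proof (cases "x < 1/3")
      case True
      \<comment> \<open>The result of inverting \<open>W\<close> twice.\<close>
      define y where "y = x / (1 - 2 * x)"
      have Tx: "x / (1 - x) \<le> 1/2"
        using True by (simp add: field_simps)
      have "1 - x / (1 - x) = (1 - 2 * x) / (1 - x)"
        using x by (simp add: field_simps)
      then have "T (T x) = y"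
        using x T_low[OF Tx] by (simp add: T_low y_def)
      moreover have "1 + 2 * y = 1 / (1 - 2 * x)"
        using x by (simp add: y_def field_simps)
      then have "fl (V_lam 1) y = x"
        using x by (simp add: fl_V) (simp add: y_def)
      moreover have "y \<in> {0..1}"
        using x True by (simp add: y_def divide_simps)
      ultimately show ?thesis
        using the_inv_into_fl_eq[OF lam(1)] lam(2) x True by simp
    next
      case False
      define z where "z = x / (1 - x)"
      have z: "1/2 < z" "z < 1"
        using x False by (auto simp: z_def field_simps)
      have x_z: "x = z / (1 + z)"
        using x by (simp add: z_def field_simps)
      obtain y where y: "y \<in> {0..1}" "fl (V_nu \<nu>) y = z"
        using nu(2) z by (metis atLeastAtMost_iff imageE less_imp_le)
      have "T (T x) = S z"
        using x z by (simp add: T_low T_high z_def)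
      also have "\<dots> = y"
        using the_inv_into_fl_eq[OF nu(1) y] nu(3) z by simp
      finally have TT: "T (T x) = y" .
      \<comment> \<open>Numerator and denominator of \<open>V_nu\<close> at \<open>y\<close>: from
        \<open>z = p / q\<close> follows \<open>W z = p / (q + p)\<close>, and \<open>q + p\<close>
        is the denominator of \<open>V_mu\<close>.\<close>
      define p where "p = 1 + (\<nu> - 1) * y"
      define q where "q = 1 + (2 * \<nu> - 1) * y"
      have q: "q \<noteq> 0"
        using nu(1) y(1) by (auto simp: fl_branch_def V_nu_def q_def)
      have p: "p = q * z"
        using y(2) q by (simp add: fl_V p_def q_def field_simps)
      have "q + p = q * (1 + z)"
        by (simp add: p algebra_simps)
      then have "x = p / (q + p)"
        using q by (simp add: x_z p)
      moreover have "q + p = 2 + (3 * \<nu> - 2) * y"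
        by (simp add: p_def q_def algebra_simps)
      ultimately have "fl (V_mu \<nu>) y = x"
        by (simp add: fl_V p_def)
      then show ?thesis
        using the_inv_into_fl_eq[OF mu(1) y(1)] mu(2) TT x False by simp
    qed
  qed
  moreover have "S x = T x" if "x \<in> interior {1/2..1} - set [0, 1/3, 1/2, 1]" for x
    using that by (simp add: T_high)
  ultimately show ?thesis
    unfolding one_step_extension_def by blast
qed

section \<open>Alternating series over arithmetic progressions\<close>

text \<open>With start and step as separate parameters the series is homogeneous of degree -1, so
  composition with a branch is a rescaling, and passing to the next term is
  \<open>q -> q + p\<close>.\<close>

definition alt_series :: "real \<Rightarrow> real \<Rightarrow> real" where
  "alt_series q p = (\<Sum>n. (-1) ^ n / (q + real n * p))"

text \<open>Leibniz criterion, as convergence is only conditional. The lower bound is the partial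
  sum of two terms; it yields positivity of the density.\<close>

lemma alt_series_summable_ge:
  assumes p: "p > 0" and q: "q > 0"
  shows summable_alt_series: "summable (\<lambda>n. (-1) ^ n / (q + real n * p))"
    and alt_series_ge: "1 / q - 1 / (q + p) \<le> alt_series q p"
proof -
  define a where "a n = 1 / (q + real n * p)" for n
  have den: "q + real n * p > 0" for n
    using p q by (simp add: add_pos_nonneg)
  have "filterlim (\<lambda>n. q + p * real n) at_top sequentially"
    by (intro filterlim_tendsto_add_at_top[OF tendsto_const]
          filterlim_tendsto_pos_mult_at_top[OF tendsto_const p] filterlim_real_sequentially)
  then have zero: "a \<longlonglongrightarrow> 0"
    unfolding a_def
    by (intro tendsto_divide_0[OF tendsto_const])
       (simp add: mult.commute filterlim_at_top_imp_at_infinity)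
  have nonneg: "0 \<le> a n" for n
    using den[of n] by (simp add: a_def)
  have decr: "a (Suc n) \<le> a n" for n
    unfolding a_def using den[of n] p by (intro frac_le) (auto simp: algebra_simps)
  have terms: "(\<lambda>n. (-1) ^ n * a n) = (\<lambda>n. (-1) ^ n / (q + real n * p))"
    by (simp add: a_def)
  note leibniz = summable_Leibniz'(1,2)[OF zero nonneg decr, unfolded terms]
  show "summable (\<lambda>n. (-1) ^ n / (q + real n * p))"
    by (rule leibniz(1))
  show "1 / q - 1 / (q + p) \<le> alt_series q p"
    using leibniz(2)[of 1] by (simp add: alt_series_def a_def numeral_2_eq_2)
qed

lemma alt_series_pos:
  assumes "p > 0" "q > 0"
  shows "alt_series q p > 0"
proof -
  have "1 / q - 1 / (q + p) > 0"
    using assms by (simp add: divide_strict_left_mono)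
  then show ?thesis
    using alt_series_ge[OF assms] by linarith
qed

text \<open>Removing the first term moves the start by one step and flips all signs.\<close>

lemma alt_series_telescope:
  assumes p: "p > 0" and q: "q > 0"
  shows "alt_series q p + alt_series (q + p) p = 1 / q"
proof -
  note summ = summable_alt_series[OF p q]
  have "alt_series q p = 1 / q + (\<Sum>n. (-1) ^ Suc n / (q + real (Suc n) * p))"
    unfolding alt_series_def using suminf_split_head[OF summ] by simp
  also have "(\<lambda>n. (-1) ^ Suc n / (q + real (Suc n) * p)) = (\<lambda>n. - ((-1) ^ n / (q + p + real n * p)))"
    by (simp add: algebra_simps)
  also have "(\<Sum>n. - ((-1) ^ n / (q + p + real n * p))) = - alt_series (q + p) p"
    unfolding alt_series_def
    using summable_alt_series[of p "q + p"] p q by (intro suminf_minus) auto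
  finally show ?thesis
    by simp
qed

lemma alt_series_scale:
  assumes "p > 0" "q > 0" "c \<noteq> 0"
  shows "alt_series (c * q) (c * p) = alt_series q p / c"
proof -
  have "(-1) ^ n / (c * q + real n * (c * p)) = (-1) ^ n / (q + real n * p) / c" for n
    by (simp add: distrib_left mult.left_commute mult.commute)
  then show ?thesis
    unfolding alt_series_def using suminf_divide[OF summable_alt_series[OF assms(1,2)], of c] by simp
qed

section \<open>The invariant density for \<open>l = 1\<close>\<close>

definition series_density :: "real \<Rightarrow> real \<Rightarrow> real" where
  "series_density \<nu> x = 1 / x * (\<Sum>n. (-1) ^ n / (1 + (\<nu> + real n - 1) * x))"

lemma series_density_eq: "series_density \<nu> x = 1 / x * alt_series (1 + (\<nu> - 1) * x) x"
  by (simp add: series_density_def alt_series_def algebra_simps)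

text \<open>For a branch with numerator \<open>p\<close> and denominator \<open>r\<close> at a
  point, and \<open>d\<close> the absolute determinant, \<open>d / r^2\<close> is the absolute
  derivative. Homogeneity cancels every power of \<open>r\<close>.\<close>

lemma series_density_transfer:
  assumes "p > 0" "r > 0" "r + (\<nu> - 1) * p > 0"
  shows "series_density \<nu> (p / r) * (d / r\<^sup>2) = d / p * alt_series (r + (\<nu> - 1) * p) p"
proof -
  have "alt_series (1 / r * (r + (\<nu> - 1) * p)) (1 / r * p) = r * alt_series (r + (\<nu> - 1) * p) p"
    using alt_series_scale[OF assms(1,3), of "1 / r"] assms by simp
  moreover have "1 / r * (r + (\<nu> - 1) * p) = 1 + (\<nu> - 1) * (p / r)"
    using assms by (simp add: field_simps)
  ultimately have "series_density \<nu> (p / r) = r / p * (r * alt_series (r + (\<nu> - 1) * p) p)"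
    by (simp add: series_density_eq)
  then show ?thesis
    using assms by (simp add: power2_eq_square)
qed

lemma invariant_density_series:
  assumes nu: "\<nu> > 0"
  shows "invariant_density [V_lam 1, V_mu \<nu>, V_nu \<nu>] (series_density \<nu>)"
  unfolding invariant_density_def
proof (intro conjI ballI)
  show "series_density \<nu> \<in> borel_measurable (restrict_space borel {0<..<1})"
    unfolding series_density_def by (intro measurable_restrict_space1) measurable
next
  fix x :: real
  assume x: "x \<in> {0<..<1}"
  \<comment> \<open>Numerator and denominator of \<open>V_nu\<close> at \<open>x\<close>; those of
    \<open>V_mu\<close> are \<open>N\<close> and \<open>N + D\<close>. Moreover, \<open>N\<close> is
    the start of the series for the density at \<open>x\<close>.\<close>
  define N where "N = 1 + (\<nu> - 1) * x"
  define D where "D = 1 + (2 * \<nu> - 1) * x"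
  have N: "N > 0" and D: "D > 0"
    using one_plus_mult_pos x nu by (auto simp: N_def D_def)
  have Nx: "1 + \<nu> * x = N + x"
    by (simp add: N_def algebra_simps)
  have q: "D + (\<nu> - 1) * N = \<nu> * (N + x)"
    by (simp add: N_def D_def algebra_simps)
  have q_pos: "\<nu> * (N + x) > 0"
    using nu N x by simp
  show "series_density \<nu> x > 0"
    using alt_series_pos[of x N] N x by (simp add: series_density_eq N_def)
  have lam: "series_density \<nu> (fl (V_lam 1) x) * \<bar>deriv (fl (V_lam 1)) x\<bar> = 1 / x * alt_series (N + x + x) x"
  proof -
    have "fl (V_lam 1) x = x / (1 + 2 * x)" "\<bar>deriv (fl (V_lam 1)) x\<bar> = 1 / (1 + 2 * x)\<^sup>2"
      using x fl_V(1)[of 1 x] by (simp_all add: deriv_fl V_lam_def fl_det_def)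
    moreover have eq: "1 + 2 * x + (\<nu> - 1) * x = N + x + x"
      by (simp add: N_def)
    ultimately show ?thesis
      using series_density_transfer[of x "1 + 2 * x" \<nu> 1, unfolded eq] N x by simp
  qed
  have mu: "series_density \<nu> (fl (V_mu \<nu>) x) * \<bar>deriv (fl (V_mu \<nu>)) x\<bar> =
              \<nu> / N * alt_series (\<nu> * (N + x) + N) N"
  proof -
    have ND: "2 + (3 * \<nu> - 2) * x = N + D"
      by (simp add: N_def D_def algebra_simps)
    have "fl (V_mu \<nu>) x = N / (N + D)"
      by (simp add: fl_V ND N_def)
    moreover have "\<bar>deriv (fl (V_mu \<nu>)) x\<bar> = \<nu> / (N + D)\<^sup>2"
      using N D nu ND by (simp add: deriv_fl V_mu_def fl_det_def)
    moreover have eq: "N + D + (\<nu> - 1) * N = \<nu> * (N + x) + N"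
      using q by simp
    ultimately show ?thesis
      using series_density_transfer[of N "N + D" \<nu> \<nu>, unfolded eq] N D q_pos by simp
  qed
  have nu': "series_density \<nu> (fl (V_nu \<nu>) x) * \<bar>deriv (fl (V_nu \<nu>)) x\<bar> =
              \<nu> / N * alt_series (\<nu> * (N + x)) N"
  proof -
    have "fl (V_nu \<nu>) x = N / D"
      by (simp add: fl_V N_def D_def)
    moreover have "\<bar>deriv (fl (V_nu \<nu>)) x\<bar> = \<nu> / D\<^sup>2"
      using D nu by (simp add: deriv_fl V_nu_def fl_det_def D_def)
    ultimately show ?thesis
      using series_density_transfer[of N D \<nu> \<nu>] N D q q_pos by simp
  qed
  \<comment> \<open>The two starts differ by exactly one step \<open>N\<close>, so the sum
    telescopes.\<close>
  have "\<nu> / N * alt_series (\<nu> * (N + x) + N) N + \<nu> / N * alt_series (\<nu> * (N + x)) N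
      = \<nu> / N * (1 / (\<nu> * (N + x)))"
    using arg_cong[OF alt_series_telescope[OF N q_pos], of "\<lambda>t. \<nu> / N * t"]
    by (simp only: distrib_left add.commute)
  also have "\<dots> = 1 / (N * (N + x))"
    using nu by simp
  also have "\<dots> = 1 / x * (1 / N - 1 / (N + x))"
    using N x by (simp add: divide_simps)
  \<comment> \<open>Telescoping twice with step \<open>x\<close> identifies this as the first two
    terms of the series at \<open>x\<close>; the branch \<open>V_lam\<close> supplies the
    rest.\<close>
  also have "1 / N - 1 / (N + x) = alt_series N x - alt_series (N + x + x) x"
    using alt_series_telescope[of x N] alt_series_telescope[of x "N + x"] N x by simp
  finally have "series_density \<nu> x = 1 / x * alt_series (N + x + x) x
      + (\<nu> / N * alt_series (\<nu> * (N + x) + N) N + \<nu> / N * alt_series (\<nu> * (N + x)) N)"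
    unfolding series_density_eq N_def[symmetric] by (simp add: algebra_simps)
  then show "series_density \<nu> x =
      (\<Sum>v\<leftarrow>[V_lam 1, V_mu \<nu>, V_nu \<nu>]. series_density \<nu> (fl v x) * \<bar>deriv (fl v) x\<bar>)"
    by (simp add: lam mu nu')
qed

theorem theorem2:
  fixes l \<mu> \<nu> :: real
    and S :: "real \<Rightarrow> real"
    and \<xi> \<eta> :: "real option"
  assumes "0 < l" and "l \<le> 1" and "\<mu> > 0" and "\<nu> > 0"
    and S_map: "pfl_map [0, 1/3, 1/2, 1] [V_lam l, V_mu \<mu>, V_nu \<nu>] S"
    and S_type: "has_type [Plus, Minus, Minus] [V_lam l, V_mu \<mu>, V_nu \<nu>]"
    and xi: "\<xi> = (if l = 1 then None else Some ((3 * l - 1) / (1 - l)))"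
    and eta_mu: "\<eta> = pfl (adj (V_mu \<mu>)) \<xi>"
    and eta_nu: "\<eta> = pfl (adj (V_nu \<nu>)) \<xi>"
    and munu: "pfl (adj (V_mu \<mu>)) \<eta> = pfl (adj (V_nu \<nu>)) (pfl (adj (V_nu \<nu>)) \<eta>)"
  shows "(\<xi> = \<eta> \<longrightarrow>
            has_natural_dual [V_lam l, V_mu \<mu>, V_nu \<nu>] \<and>
            (\<exists>s. \<xi> = Some s \<and>
               invariant_density [V_lam l, V_mu \<mu>, V_nu \<nu>] (\<lambda>x. 1 / (1 + s * x)\<^sup>2)))
       \<and> (\<xi> \<noteq> \<eta> \<longrightarrow>
            \<nu> = \<mu> \<and> l = 1 \<and>
            one_step_extension [0, 1/3, 1/2, 1] S \<and>
            (\<forall>x\<in>{0<..<1}. summable (\<lambda>n. (-1) ^ n / (1 + (\<nu> + real n - 1) * x))) \<and>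
            invariant_density [V_lam l, V_mu \<mu>, V_nu \<nu>]
              (\<lambda>x. 1 / x * (\<Sum>n. (-1) ^ n / (1 + (\<nu> + real n - 1) * x))))"
proof (cases "l = 1")
  case True
  \<comment> \<open>The adjoint branches send infinity to \<open>\<mu> - 1\<close> and
    \<open>\<nu> - 1\<close>. These agree and are finite, so the first implication is vacuous
    here.\<close>
  then have nu_mu: "\<nu> = \<mu>" and xi_eta: "\<xi> \<noteq> \<eta>"
    using xi eta_mu eta_nu by (simp_all add: pfl_adj_V del: pfl.simps)
  have "summable (\<lambda>n. (-1) ^ n / (1 + (\<nu> + real n - 1) * x))" if "x \<in> {0<..<1}" for x
    using summable_alt_series[of x "1 + (\<nu> - 1) * x"] one_plus_mult_pos[of "\<nu> - 1" x] that \<open>\<nu> > 0\<close>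
    by (simp add: algebra_simps)
  moreover have "one_step_extension [0, 1/3, 1/2, 1] S"
    using one_step_extension_if_lam_1 S_map True nu_mu by simp
  moreover have "invariant_density [V_lam l, V_mu \<mu>, V_nu \<nu>]
      (\<lambda>x. 1 / x * (\<Sum>n. (-1) ^ n / (1 + (\<nu> + real n - 1) * x)))"
    using invariant_density_series[OF \<open>\<nu> > 0\<close>] True nu_mu by (simp add: series_density_def[abs_def])
  ultimately show ?thesis
    using True nu_mu xi_eta by blast
next
  case False
  have branches: "fl_branch (V_lam l)" "fl_branch (V_mu \<mu>)" "fl_branch (V_nu \<nu>)"
    using S_map by (auto simp: pfl_map_def All_less_Suc numeral_3_eq_3)
  define s where "s = (3 * l - 1) / (1 - l)"
  have xi_s: "\<xi> = Some s"
    using xi False by (simp add: s_def)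
  have "l < 1"
    using False \<open>l \<le> 1\<close> by simp
  note fixed = common_fixed_point[OF \<open>0 < l\<close> this \<open>\<mu> > 0\<close> \<open>\<nu> > 0\<close> branches s_def
      eta_mu[unfolded xi_s] eta_nu[unfolded xi_s] munu]
  \<comment> \<open>Since \<xi> = \<eta> has been derived, the second implication is
    vacuous.\<close>
  show ?thesis
    using fixed xi_s by blast
qed

end
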